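(* Let $f_n(s)$ ($n\geqslant 1$) be the functions defined by the differential-difference system below, and let $h$ be the function below. For each integer $n$ with $2\leqslant n\leqslant 450$, let $c$ be the constant assigned to $n$ by the following table: $c=0.33$ for $n=2$; $c=0.39$ for $n=3$; $c=0.45$ for $n=4$; $c=0.51$ for $n=5$; $c=0.54$ for $n=6$; $c=0.57$ for $n=7$; $c=0.58$ for $n=8$; $c=0.61$ for $n=9,10$; $c=0.63$ for $11\leqslant n\leqslant 12$; $c=0.64$ for $n=13$; $c=0.65$ for $n=14$; $c=0.66$ for $15\leqslant n\leqslant 18$; $c=0.67$ for $19\leqslant n\leqslant 20$; $c=0.68$ for $21\leqslant n\leqslant 24$; $c=0.69$ for $25\leqslant n\leqslant 32$; $c=0.7$ for $33\leqslant n\leqslant 46$; $c=0.71$ for $47\leqslant n\leqslant 80$; $c=0.72$ for $81\leqslant n\leqslant 308$; $c=0.73$ for $309\leqslant n\leqslant 450$. Then, if $n$ is odd and $s\geqslant 1$, or if $n$ is even and $s\geqslant 2$, $$f_n(s)\leqslant 2e^2 c^{\,n-1} h(s).$$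
   Context: The functions $f_n$ are defined by: $f_n(s)=0$ for $s\geqslant n+2$; $sf_1(s)=3-s$ for $1\leqslant s\leqslant 3$; $(sf_n(s))'=-f_{n-1}(s-1)$ for $n\geqslant 2$ even and $s\geqslant 2$; $(sf_n(s))'=-f_{n-1}(s-1)$ for $n\geqslant 2$ odd and $s\geqslant 3$; $(sf_n(s))'=0$ for $n\geqslant 2$ odd and $1\leqslant s\leqslant 3$. (So $f_n$ is defined for $s\geqslant 1$ when $n$ is odd and for $s\geqslant 2$ when $n$ is even.) The function $h$ is $h(s)=e^{-2}$ for $1\leqslant s\leqslant 2$, $h(s)=e^{-s}$ for $2\leqslant s\leqslant 3$, and $h(s)=3s^{-1}e^{-s}$ for $s\geqslant 3$. *)

theory Defs
  imports "HOL-Analysis.Analysis"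
begin

(* The system only constrains f n on [1, \<infinity>) for odd n and on [2, \<infinity>) for even n; values of f
   outside these domains and f 0 are irrelevant.  At the endpoints of the intervals on which a
   differential equation is imposed, the derivative is one-sided.  In particular, for odd n \<ge> 3
   both equations hold at s = 3, each from its own side, so s f n s is continuous there; it is
   in general not differentiable at 3. *)
definition sieve_system :: "(nat \<Rightarrow> real \<Rightarrow> real) \<Rightarrow> bool" where
  "sieve_system f \<longleftrightarrow>
     (\<forall>n\<ge>1. \<forall>s\<ge>real n + 2. f n s = 0) \<and>
     (\<forall>s\<in>{1..3}. s * f 1 s = 3 - s) \<and>
     (\<forall>n\<ge>2. even n \<longrightarrow> (\<forall>s\<ge>2.
        ((\<lambda>u. u * f n u) has_real_derivative - f (n - 1) (s - 1)) (at s within {2..}))) \<and>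
     (\<forall>n\<ge>2. odd n \<longrightarrow> (\<forall>s\<ge>3.
        ((\<lambda>u. u * f n u) has_real_derivative - f (n - 1) (s - 1)) (at s within {3..}))) \<and>
     (\<forall>n\<ge>2. odd n \<longrightarrow> (\<forall>s\<in>{1..3}.
        ((\<lambda>u. u * f n u) has_real_derivative 0) (at s within {1..3})))"

(* Only used for s \<ge> 1. *)
definition h :: "real \<Rightarrow> real" where
  "h s = (if s \<le> 2 then exp (- 2) else if s \<le> 3 then exp (- s) else 3 / s * exp (- s))"

(* Only used for 2 \<le> n \<le> 450. *)
definition c :: "nat \<Rightarrow> real" where
  "c n =
     (if n = 2 then 0.33
      else if n = 3 then 0.39
      else if n = 4 then 0.45
      else if n = 5 then 0.51
      else if n = 6 then 0.54
      else if n = 7 then 0.57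
      else if n = 8 then 0.58
      else if n \<in> {9, 10} then 0.61
      else if n \<in> {11..12} then 0.63
      else if n = 13 then 0.64
      else if n = 14 then 0.65
      else if n \<in> {15..18} then 0.66
      else if n \<in> {19..20} then 0.67
      else if n \<in> {21..24} then 0.68
      else if n \<in> {25..32} then 0.69
      else if n \<in> {33..46} then 0.7
      else if n \<in> {47..80} then 0.71
      else if n \<in> {81..308} then 0.72
      else 0.73)"

lemma has_primitive:
  fixes p :: "real \<Rightarrow> real"
  assumes "continuous_on UNIV p"
  shows "\<exists>P. \<forall>x. (P has_real_derivative p x) (at x)"
proof -
  have "\<exists>F. \<forall>x. -\<infinity> < ereal x \<longrightarrow> ereal x < \<infinity> \<longrightarrow> (F has_vector_derivative p x) (at x)"
    using assms by (intro einterval_antiderivative)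
      (auto simp: continuous_on_eq_continuous_at)
  then show ?thesis
    by (auto simp: has_real_derivative_iff_has_vector_derivative)
qed

(* The system is consistent, and it determines f on the stated domains. *)
lemma sieve_system_exists: "\<exists>f. sieve_system f"
proof -
  define prim :: "(real \<Rightarrow> real) \<Rightarrow> real \<Rightarrow> real"
    where "prim p = (SOME P. \<forall>x. (P has_real_derivative p x) (at x))" for p
  have prim: "(prim p has_real_derivative p x) (at x)" if "continuous_on UNIV p" for p x
    using someI_ex[OF has_primitive[OF that]] unfolding prim_def by blast
  define b :: "nat \<Rightarrow> real" where "b k = (if even k then 2 else 3)" for k
  define q :: "(real \<Rightarrow> real) \<Rightarrow> real \<Rightarrow> real" where "q g t = g (t - 1) / max 1 (t - 1)" for g t
  define G :: "nat \<Rightarrow> real \<Rightarrow> real" where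
    "G = rec_nat (\<lambda>s. max 0 (3 - s))
           (\<lambda>k g s. prim (q g) (real k + 4) - prim (q g) (max s (b k)))"
  have G0: "G 0 s = max 0 (3 - s)" for s by (simp add: G_def)
  have GS: "G (Suc k) s = prim (q (G k)) (real k + 4) - prim (q (G k)) (max s (b k))" for k s
    by (simp add: G_def)
  have cq: "continuous_on UNIV (q g)" if "continuous_on UNIV g" for g
    unfolding q_def
    by (intro continuous_intros continuous_on_compose2[OF that]) auto
  have cG: "continuous_on UNIV (G k)" for k
  proof (induction k)
    case 0
    show ?case unfolding G0[abs_def] by (intro continuous_intros)
  next
    case (Suc k)
    have P: "continuous_on UNIV (prim (q (G k)))"
      by (intro continuous_at_imp_continuous_on ballI DERIV_isCont[OF prim[OF cq[OF Suc]]])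
    show ?case
      unfolding GS[abs_def]
      by (intro continuous_on_diff continuous_on_const
          continuous_on_compose2[OF P _ subset_UNIV] continuous_on_max continuous_on_id)
  qed
  note der = prim[OF cq[OF cG]]
  have zero: "G k s = 0" if "s \<ge> real k + 3" for k s
    using that
  proof (induction k arbitrary: s)
    case 0
    then show ?case by (simp add: G0)
  next
    case (Suc k)
    have "q (G k) t = 0" if "t \<ge> real k + 4" for t
      using Suc.IH[of "t - 1"] that by (simp add: q_def)
    then have "(prim (q (G k)) has_real_derivative 0) (at x within {real k + 4..})"
      if "x \<in> {real k + 4..}" for x
      using der[of k x] that by (metis atLeast_iff has_field_derivative_at_within)
    then have "\<exists>C. \<forall>x\<in>{real k + 4..}. prim (q (G k)) x = C"
      by (intro has_field_derivative_zero_constant) auto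
    then have "prim (q (G k)) (real k + 4) = prim (q (G k)) s" using Suc.prems by force
    moreover have "max s (b k) = s" using Suc.prems by (auto simp: b_def)
    ultimately show ?case by (simp add: GS)
  qed
  define f where "f n s = G (n - 1) s / max 1 s" for n s
  have sf: "u * f n u = G (n - 1) u" if "u \<ge> 1" for u n
    using that by (simp add: f_def)
  have d: "((\<lambda>u. u * f n u) has_real_derivative - f (n - 1) (s - 1)) (at s within {b n..})"
    if "n \<ge> 2" "s \<ge> b n" for n s
  proof -
    define k where "k = n - 2"
    have k: "n = Suc (Suc k)" using that by (simp add: k_def)
    have "((\<lambda>u. prim (q (G k)) (real k + 4) - prim (q (G k)) u) has_real_derivative
            - q (G k) s) (at s within {b n..})"
      using DERIV_diff[OF DERIV_const has_field_derivative_at_within[OF der[of k s]],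
          of "prim (q (G k)) (real k + 4)" "{b n..}"] by simp
    then show ?thesis
    proof (rule has_field_derivative_transform_within[OF _ zero_less_one, THEN DERIV_cong])
      show "s \<in> {b n..}" using that by simp
      fix u assume "u \<in> {b n..}"
      then have "u \<ge> 1" "max u (b k) = u" by (auto simp: b_def k split: if_splits)
      then show "prim (q (G k)) (real k + 4) - prim (q (G k)) u = u * f n u"
        using sf[of u n] by (simp add: k GS)
    next
      show "- q (G k) s = - f (n - 1) (s - 1)" by (simp add: q_def f_def k)
    qed
  qed
  have d0: "((\<lambda>u. u * f n u) has_real_derivative 0) (at s within {1..3})"
    if "n \<ge> 2" "odd n" "s \<in> {1..3}" for n s
  proof -
    define k where "k = n - 2"
    have k: "n = Suc (Suc k)" using that by (simp add: k_def)
    have "((\<lambda>u. prim (q (G k)) (real k + 4) - prim (q (G k)) 3) has_real_derivative 0)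
            (at s within {1..3})" by simp
    then show ?thesis
    proof (rule has_field_derivative_transform_within[OF _ zero_less_one])
      show "s \<in> {1..3}" using that by simp
      fix u :: real assume "u \<in> {1..3}"
      then have "u \<ge> 1" "max u (b k) = 3" using that by (auto simp: b_def k split: if_splits)
      then show "prim (q (G k)) (real k + 4) - prim (q (G k)) 3 = u * f n u"
        using sf[of u n] by (simp add: k GS)
    qed
  qed
  have "sieve_system f"
    unfolding sieve_system_def
  proof (intro conjI allI impI ballI)
    fix n :: nat and s :: real assume "n \<ge> 1" "s \<ge> real n + 2"
    then show "f n s = 0" by (simp add: f_def zero)
  next
    fix s :: real assume "s \<in> {1..3}"
    then show "s * f 1 s = 3 - s" by (simp add: sf G0)
  next
    fix n :: nat and s :: real assume "n \<ge> 2" "even n" "s \<ge> 2"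
    then show "((\<lambda>u. u * f n u) has_real_derivative - f (n - 1) (s - 1)) (at s within {2..})"
      using d[of n s] by (simp add: b_def)
  next
    fix n :: nat and s :: real assume "n \<ge> 2" "odd n" "s \<ge> 3"
    then show "((\<lambda>u. u * f n u) has_real_derivative - f (n - 1) (s - 1)) (at s within {3..})"
      using d[of n s] by (simp add: b_def)
  qed (use d0 in auto)
  then show ?thesis by blast
qed

lemma sieve_system_upper:
  assumes "sieve_system f" "n \<ge> 2" "s \<ge> (if even n then 2 else 3)"
  shows "((\<lambda>u. u * f n u) has_real_derivative - f (n - 1) (s - 1))
           (at s within {if even n then 2 else 3..})"
proof (cases "even n")
  case True
  then show ?thesis using assms unfolding sieve_system_def by simp
next
  case False
  then show ?thesis using assms unfolding sieve_system_def by simp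
qed

lemma sieve_system_lower:
  assumes "sieve_system f" "n \<ge> 2" "odd n" "s \<in> {1..3}"
  shows "((\<lambda>u. u * f n u) has_real_derivative 0) (at s within {1..3})"
  using assms unfolding sieve_system_def by blast

lemma sieve_system_unique:
  assumes f: "sieve_system f" and g: "sieve_system g"
    and "n \<ge> 1" "odd n \<and> s \<ge> 1 \<or> even n \<and> s \<ge> 2"
  shows "f n s = g n s"
  using assms(3,4)
proof (induction n arbitrary: s rule: dec_induct)
  case base
  have "s * f 1 s = 3 - s \<and> s * g 1 s = 3 - s" if "s \<le> 3"
    using f g base that by (simp add: sieve_system_def)
  moreover have "f 1 s = 0 \<and> g 1 s = 0" if "s \<ge> 3"
    using f g that by (simp add: sieve_system_def)
  moreover have "s \<noteq> 0" using base by auto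
  ultimately show ?case by (metis linear mult_left_cancel)
next
  case (step n)
  let ?N = "Suc n"
  define b :: real where "b = (if even ?N then 2 else 3)"
  let ?D = "\<lambda>u. u * f ?N u - u * g ?N u"
  have "(?D has_real_derivative 0) (at x within {b..})" if "x \<in> {b..}" for x
  proof -
    have "f n (x - 1) = g n (x - 1)"
      using that by (intro step.IH) (auto simp: b_def split: if_splits)
    moreover have df: "((\<lambda>u. u * f ?N u) has_real_derivative - f n (x - 1)) (at x within {b..})"
      and dg: "((\<lambda>u. u * g ?N u) has_real_derivative - g n (x - 1)) (at x within {b..})"
      using sieve_system_upper[OF f, of ?N x] sieve_system_upper[OF g, of ?N x] that step.hyps
      by (simp_all add: b_def)
    ultimately show ?thesis using DERIV_diff[OF df dg] by simp
  qed
  then have "\<exists>C. \<forall>x\<in>{b..}. ?D x = C"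
    by (intro has_field_derivative_zero_constant) auto
  then obtain C where C: "\<And>x. x \<ge> b \<Longrightarrow> ?D x = C" by auto
  have "f ?N (real n + 3) = 0" "g ?N (real n + 3) = 0"
    using f g by (auto simp: sieve_system_def)
  moreover have "real n + 3 \<ge> b" by (simp add: b_def)
  ultimately have "C = 0" using C[of "real n + 3"] by simp
  with C have above: "?D x = 0" if "x \<ge> b" for x using that by simp
  have "?D s = 0"
  proof (cases "s \<ge> b")
    case True
    then show ?thesis by (rule above)
  next
    case False
    with step.prems have odd: "odd ?N" and s: "s \<in> {1..3}" and b: "b = 3"
      by (auto simp: b_def split: if_splits)
    have "(?D has_real_derivative 0) (at x within {1..3})" if "x \<in> {1..3}" for x
    proof -
      have df: "((\<lambda>u. u * f ?N u) has_real_derivative 0) (at x within {1..3})"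
        and dg: "((\<lambda>u. u * g ?N u) has_real_derivative 0) (at x within {1..3})"
        using step.hyps odd that by (intro sieve_system_lower f g; simp)+
      show ?thesis using DERIV_diff[OF df dg] by simp
    qed
    then have "\<exists>C. \<forall>x\<in>{1..3}. ?D x = C"
      by (intro has_field_derivative_zero_constant) auto
    then have "?D s = ?D 3" using s by fastforce
    then show ?thesis using above[of 3] b by simp
  qed
  moreover have "s \<ge> 1" using step.prems by auto
  ultimately show ?case by simp
qed

end

theory Submission
  imports Defs
begin

text \<open>
  Write \<open>F n s = s * f n s\<close>. On the half line where the equation for \<open>F n\<close> holds, \<open>F n\<close> is
  decreasing and convex, because \<open>f (n - 1)\<close> is decreasing; so \<open>f n\<close> is convex there too, and the
  trapezoid rule bounds \<open>F n\<close> from above in terms of values of \<open>F (n - 1)\<close> on the grid \<open>i / 16\<close>.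
  The grid is cut off at \<open>s = 8\<close> with \<open>F n s \<le> f (n - 1) (s - 1)\<close>, which holds since \<open>f (n - 1)\<close>
  decays at least as fast as \<open>exp (- s)\<close>. The same decay rate and convexity reduce the
  comparison with \<open>h\<close> to the values of \<open>F n\<close> at 2, 3, 4 (\<open>n\<close> even) or at 3 (\<open>n\<close> odd).

  The discretised recursion is carried out in integers up to \<open>n = 28\<close>. By then two steps multiply
  each grid bound by at most 0.5234, so the bounds for \<open>n = 26\<close> and \<open>n = 27\<close> extend geometrically to
  all larger \<open>n\<close>; this is good enough up to \<open>n = 450\<close>.
\<close>

subsection \<open>Real analysis\<close>

lemma convex_on_transform:
  assumes "convex_on S g" "\<And>u. u \<in> S \<Longrightarrow> f u = g u"
  shows "convex_on S f"
proof -
  have "u *\<^sub>R x + v *\<^sub>R y \<in> S" if "x \<in> S" "y \<in> S" "0 \<le> u" "0 \<le> v" "u + v = 1" for x y u v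
    using convex_on_imp_convex[OF assms(1)] that by (rule convexD)
  with assms show ?thesis unfolding convex_on_def by simp
qed

text \<open>Multiplying the two chord bounds gives the chord of the product minus
  \<open>t * (1 - t) * ((f x - f y) * (g x - g y))\<close>, and this term is nonnegative because
  both functions decrease.\<close>

lemma convex_on_mul_antimono:
  fixes S :: "real set"
  assumes f: "convex_on S f" and g: "convex_on S g"
    and "antimono_on S f" "antimono_on S g"
    and fpos: "\<And>x. x \<in> S \<Longrightarrow> 0 \<le> f x" and gpos: "\<And>x. x \<in> S \<Longrightarrow> 0 \<le> g x"
  shows "convex_on S (\<lambda>x. f x * g x)"
proof (rule convex_on_linorderI)
  show "convex S" using f by (rule convex_on_imp_convex)
  fix t x y :: real
  assume t: "0 < t" "t < 1" and xy: "x \<in> S" "y \<in> S" "x < y"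
  let ?z = "(1 - t) *\<^sub>R x + t *\<^sub>R y"
  have z: "?z \<in> S"
    using \<open>convex S\<close> t xy by (simp add: convex_alt)
  have "f ?z * g ?z \<le> ((1 - t) * f x + t * f y) * ((1 - t) * g x + t * g y)"
    using convex_onD[OF f, of t x y] convex_onD[OF g, of t x y] t xy fpos gpos z
    by (intro mult_mono) auto
  also have "\<dots> = (1 - t) * (f x * g x) + t * (f y * g y) - t * (1 - t) * ((f x - f y) * (g x - g y))"
    by (simp add: algebra_simps power2_eq_square)
  also have "\<dots> \<le> (1 - t) * (f x * g x) + t * (f y * g y)"
    using t xy assms(3,4) by (simp add: monotone_on_def)
  finally show "f ?z * g ?z \<le> (1 - t) * (f x * g x) + t * (f y * g y)" .
qed

text \<open>Derivatives within \<open>S\<close> let the equations be used up to the end of a half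
  line, where they are one-sided.\<close>

lemma mvt_within:
  fixes F F' :: "real \<Rightarrow> real"
  assumes "x < y" "{x..y} \<subseteq> S"
    and der: "\<And>u. u \<in> {x..y} \<Longrightarrow> (F has_real_derivative F' u) (at u within S)"
  obtains v where "x < v" "v < y" "F y - F x = F' v * (y - x)"
proof -
  have "\<exists>v\<in>{x<..<y}. F y - F x = F' v * (y - x)"
  proof (rule mvt_simple[where f' = "\<lambda>v. (*) (F' v)"])
    fix v assume "x \<le> v" "v \<le> y"
    then have "(F has_real_derivative F' v) (at v within {x..y})"
      using assms(2) by (intro DERIV_subset[OF der]) auto
    then show "(F has_derivative (*) (F' v)) (at v within {x..y})"
      by (simp add: has_field_derivative_def)
  qed (use assms in auto)
  then show thesis using that by auto
qed

lemma antimono_within: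
  fixes F F' :: "real \<Rightarrow> real"
  assumes "x \<le> y" "{x..y} \<subseteq> S"
    and der: "\<And>u. u \<in> {x..y} \<Longrightarrow> (F has_real_derivative F' u) (at u within S)"
    and neg: "\<And>u. u \<in> {x..y} \<Longrightarrow> F' u \<le> 0"
  shows "F y \<le> F x"
proof (cases "x = y")
  case False
  with assms(1) have "x < y" by simp
  from mvt_within[OF this assms(2) der] obtain v
    where v: "x < v" "v < y" "F y - F x = F' v * (y - x)" by blast
  with neg[of v] \<open>x < y\<close> have "F' v * (y - x) \<le> 0" by (simp add: mult_nonpos_nonneg)
  with v show ?thesis by simp
qed simp

text \<open>Mean values on the two sides of \<open>z\<close> give slopes \<open>- q v\<close> and
  \<open>- q w\<close> with \<open>v < w\<close>, so the slope does not drop at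
  \<open>z\<close>.\<close>

lemma convex_on_antimono_minus_derivative:
  fixes F q :: "real \<Rightarrow> real"
  assumes der: "\<And>x. a \<le> x \<Longrightarrow> (F has_real_derivative - q x) (at x within {a..})"
    and q: "antimono_on {a..} q"
  shows "convex_on {a..} F"
proof (rule convex_on_linorderI)
  fix t x y :: real
  assume t: "0 < t" "t < 1" and xy: "x \<in> {a..}" "y \<in> {a..}" "x < y"
  define z where "z = (1 - t) *\<^sub>R x + t *\<^sub>R y"
  have zx: "z - x = t * (y - x)" and yz: "y - z = (1 - t) * (y - x)"
    by (simp_all add: z_def algebra_simps)
  have "0 < t * (y - x)" "0 < (1 - t) * (y - x)" using t xy by simp_all
  then have ord: "x < z" "z < y" unfolding zx[symmetric] yz[symmetric] by simp_all
  obtain v where v: "x < v" "v < z" "F z - F x = - q v * (z - x)"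
    by (rule mvt_within[of x z "{a..}" F "\<lambda>v. - q v"]) (use der xy ord in auto)
  obtain w where w: "z < w" "w < y" "F y - F z = - q w * (y - z)"
    by (rule mvt_within[of z y "{a..}" F "\<lambda>v. - q v"]) (use der xy ord in auto)
  have "q w \<le> q v" using q v w xy by (auto simp: monotone_on_def)
  then have "t * (1 - t) * (y - x) * (q w - q v) \<le> 0"
    using t xy by (simp add: mult_nonneg_nonpos)
  moreover have "(1 - t) * F x + t * F y - F z = t * (F y - F z) - (1 - t) * (F z - F x)"
    by (simp add: algebra_simps)
  moreover have "t * (F y - F z) - (1 - t) * (F z - F x) = - (t * (1 - t) * (y - x) * (q w - q v))"
    unfolding v(3) w(3) zx yz by (simp add: algebra_simps)
  ultimately have "F z \<le> (1 - t) * F x + t * F y" by linarith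
  then show "F ((1 - t) *\<^sub>R x + t *\<^sub>R y) \<le> (1 - t) * F x + t * F y" by (simp add: z_def)
qed simp

text \<open>A convex \<open>g\<close> lies below its chord. Adding to \<open>F\<close> the integral
  of that chord gives \<open>G\<close>, which is therefore nondecreasing;
  \<open>G x \<le> G y\<close> is the claim.\<close>

lemma trapezoid_upper:
  fixes F g :: "real \<Rightarrow> real"
  assumes "x < y" and der: "\<And>u. u \<in> {x..y} \<Longrightarrow> (F has_real_derivative - g (u - 1)) (at u within {x..y})"
    and cvx: "convex_on {x - 1..y - 1} g"
  shows "F x \<le> F y + (y - x) / 2 * (g (x - 1) + g (y - 1))"
proof -
  define D where "D = (g (y - 1) - g (x - 1)) / (y - x)"
  define G where "G u = F u + g (x - 1) * (u - x) + D * (u - x)\<^sup>2 / 2" for u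
  have "- G y \<le> - G x"
  proof (rule antimono_within[where F = "\<lambda>u. - G u" and S = "{x..y}"
        and F' = "\<lambda>u. g (u - 1) - g (x - 1) - D * (u - x)"])
    fix u assume u: "u \<in> {x..y}"
    show "((\<lambda>u. - G u) has_real_derivative g (u - 1) - g (x - 1) - D * (u - x)) (at u within {x..y})"
      unfolding G_def using der[OF u] by (auto intro!: derivative_eq_intros)
    show "g (u - 1) - g (x - 1) - D * (u - x) \<le> 0"
      using convex_onD_Icc'[OF cvx, of "u - 1"] u by (simp add: D_def)
  qed (use \<open>x < y\<close> in auto)
  moreover have "D * (y - x)\<^sup>2 = (g (y - 1) - g (x - 1)) * (y - x)"
    using \<open>x < y\<close> by (simp add: D_def power2_eq_square)
  ultimately show ?thesis by (simp add: G_def field_simps)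
qed

section \<open>Elementary inequalities for the logarithm and the exponential\<close>

lemma ln_three_half_bound: "ln (3 / 2 :: real) \<le> 5 / 12"
proof -
  have "3 / 2 \<le> 1 + 5 / 12 + (5 / 12)\<^sup>2 / (2::real)" by (simp add: power2_eq_square)
  also have "\<dots> \<le> exp (5 / 12)" by (rule exp_lower_Taylor_quadratic) simp
  finally have "ln (3 / 2) \<le> ln (exp (5 / 12 :: real))" by (subst ln_le_cancel_iff) auto
  then show ?thesis by simp
qed

text \<open>The estimate behind \<open>sieve_ratio_even_left\<close>. The logarithm is expanded at
  \<open>x = 2\<close>; with 5/12 for \<open>ln (3 / 2)\<close> the constants add up to -1/4, and
  the two sides then differ by \<open>(x - 2)^2 / 4\<close>.\<close>

lemma square_times_log_le:
  fixes x :: real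
  assumes "1 \<le> x"
  shows "x\<^sup>2 * (1 / 3 + ln (3 / x)) \<le> x + 1"
proof -
  have "ln (3 / x) = ln (3 / 2) + ln (2 / x)"
    using assms by (simp add: ln_div)
  also have "\<dots> \<le> 5 / 12 + (2 / x - 1)"
    using assms by (intro add_mono ln_three_half_bound ln_le_minus_one) simp
  finally have "x\<^sup>2 * (1 / 3 + ln (3 / x)) \<le> x\<^sup>2 * (1 / 3 + (5 / 12 + (2 / x - 1)))"
    by (intro mult_left_mono) auto
  also have "\<dots> = 2 * x - x\<^sup>2 / 4"
    using assms by (simp add: power2_eq_square field_simps)
  also have "\<dots> \<le> x + 1"
    using zero_le_power2[of "x - 2"] by (simp add: power2_eq_square algebra_simps)
  finally show ?thesis .
qed

lemma exp_one_squared: "(exp 1)\<^sup>2 = (exp 2 :: real)"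
  by (simp add: power2_eq_square flip: exp_add)

text \<open>For the comparison with \<open>h\<close> on [2, 3]: the first bound serves odd
  \<open>n\<close>, where \<open>s * f n s\<close> is constant there; the second serves even
  \<open>n\<close>, with \<open>4 - s\<close> as the chord between 2 and 3.\<close>

lemma exp_minus_two_ge:
  fixes s :: real
  assumes "2 \<le> s" "s \<le> 3"
  shows "exp 2 * exp (- s) \<ge> 1 / s" "exp 2 * exp (- s) * s \<ge> 4 - s"
proof -
  define x where "x = s - 2"
  have x: "0 \<le> x" "x \<le> 1" and s: "s = x + 2" using assms by (simp_all add: x_def)
  have E: "exp 2 * exp (- s) = exp (- x)" by (simp add: s flip: exp_add)
  have "exp x \<le> 1 + x + x\<^sup>2" using x by (rule exp_bound)
  also have "\<dots> \<le> s" using x by (simp add: s power2_eq_square mult_le_one)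
  finally have "exp x \<le> s" .
  then have "1 / s \<le> 1 / exp x" using assms by (intro divide_left_mono) auto
  then show "exp 2 * exp (- s) \<ge> 1 / s" unfolding E by (simp add: exp_minus inverse_eq_divide)
  have "(2 + x) * exp (- x) - (2 - x) \<ge> (2 + 0) * exp (- 0) - (2 - (0::real))"
  proof (rule DERIV_nonneg_imp_nondecreasing[OF x(1)])
    fix y :: real assume y: "0 \<le> y" "y \<le> x"
    have "((\<lambda>x. (2 + x) * exp (- x) - (2 - x)) has_real_derivative 1 - (1 + y) * exp (- y)) (at y)"
      by (auto intro!: derivative_eq_intros simp: algebra_simps)
    moreover have "(1 + y) * exp (- y) \<le> exp y * exp (- y)"
      using exp_ge_add_one_self[of y] by (intro mult_right_mono) auto
    then have "0 \<le> 1 - (1 + y) * exp (- y)" by (simp flip: exp_add)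
    ultimately show "\<exists>D. ((\<lambda>x. (2 + x) * exp (- x) - (2 - x)) has_real_derivative D) (at y) \<and> 0 \<le> D"
      by blast
  qed
  then show "exp 2 * exp (- s) * s \<ge> 4 - s"
    unfolding E by (simp add: s algebra_simps)
qed

lemma exp_le_two_72: "exp 1 \<le> (2.72 :: real)"
  using e_approx_32 by (simp add: abs_if split: if_splits)

text \<open>A slightly lowered tangent of \<open>3 * exp (2 - s)\<close> at \<open>s = 7 / 2\<close>.\<close>

lemma exp_minus_tangent:
  fixes s :: real
  assumes "s \<le> 9 / 2"
  shows "3 - 2 * s / 3 \<le> 3 * (exp 2 * exp (- s))"
proof -
  have e: "exp (3 / 2) \<le> (9 / 2 :: real)"
  proof (rule power2_le_imp_le)
    have "(exp (3 / 2))\<^sup>2 = exp (1::real) ^ 3"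
      by (simp flip: exp_of_nat_mult)
    also have "\<dots> \<le> 2.72 ^ 3" by (intro power_mono exp_le_two_72) auto
    also have "\<dots> \<le> (9 / 2)\<^sup>2" by (simp add: power2_eq_square power3_eq_cube)
    finally show "(exp (3 / 2))\<^sup>2 \<le> (9 / 2 :: real)\<^sup>2" .
  qed simp
  have "3 - 2 * s / 3 = 3 * (9 / 2 - s) * (2 / 9)" by simp
  also have "\<dots> \<le> 3 * (9 / 2 - s) * exp (- (3 / 2))"
    using e assms by (intro mult_left_mono) (auto simp: exp_minus field_simps)
  also have "\<dots> \<le> 3 * exp (7 / 2 - s) * exp (- (3 / 2))"
    using exp_ge_add_one_self[of "7 / 2 - s"] by simp
  also have "\<dots> = 3 * (exp 2 * exp (- s))" by (simp flip: exp_add)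
  finally show ?thesis .
qed

text \<open>Evaluating \<open>q ^ (i * l)\<close> as \<open>(q ^ i) ^ l\<close> with an intermediate rounding \<open>p\<close> keeps the numerals
  short.\<close>

lemma geometric_bound:
  fixes w \<beta> M q p r :: real
  assumes "0 < w" "0 \<le> r" "r \<le> q * w\<^sup>2" "1 \<le> q" "q ^ i \<le> p" "k \<le> i * l" "0 \<le> \<beta>"
    and \<beta>: "p ^ l * \<beta> \<le> M * w ^ d"
  shows "r ^ k * \<beta> \<le> M * w ^ (d + 2 * k)"
proof -
  have "r ^ k \<le> (q * w\<^sup>2) ^ k" using assms by (intro power_mono) auto
  also have "\<dots> = q ^ k * w ^ (2 * k)" by (simp add: power_mult_distrib power_mult)
  also have "\<dots> \<le> p ^ l * w ^ (2 * k)"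
  proof (rule mult_right_mono)
    have "q ^ k \<le> q ^ (i * l)" using assms by (intro power_increasing) auto
    also have "\<dots> = (q ^ i) ^ l" by (rule power_mult)
    also have "\<dots> \<le> p ^ l" using assms by (intro power_mono) auto
    finally show "q ^ k \<le> p ^ l" .
  qed (use assms in simp)
  finally have "r ^ k * \<beta> \<le> p ^ l * w ^ (2 * k) * \<beta>" using assms by (intro mult_right_mono) auto
  also have "\<dots> = p ^ l * \<beta> * w ^ (2 * k)" by simp
  also have "\<dots> \<le> M * w ^ d * w ^ (2 * k)" using assms by (intro mult_right_mono) auto
  finally show ?thesis by (simp add: power_add mult.assoc)
qed

subsection \<open>Monotonicity, convexity and decay\<close>

text \<open>For \<open>n \<ge> 2\<close> the differential-difference equation for \<open>f n\<close> holds on \<open>{kink n..}\<close>.\<close>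

definition kink :: "nat \<Rightarrow> real" where "kink n = (if even n then 2 else 3)"
definition left_end :: "nat \<Rightarrow> real" where "left_end n = (if even n then 2 else 1)"

lemma left_end_pos: "0 < left_end n"
  by (simp add: left_end_def)

text \<open>Hence the shifted argument in the equation for \<open>f (Suc n)\<close> stays in the
  domain of \<open>f n\<close>.\<close>

lemma left_end_le_kink_Suc: "left_end n \<le> kink (Suc n) - 1"
  by (auto simp: left_end_def kink_def)

context
  fixes f :: "nat \<Rightarrow> real \<Rightarrow> real"
  assumes sys: "sieve_system f"
begin

lemma sieve_vanishes: "n \<ge> 1 \<Longrightarrow> s \<ge> real n + 2 \<Longrightarrow> f n s = 0"
  using sys by (simp add: sieve_system_def)

lemma sieve_first: "1 \<le> s \<Longrightarrow> s * f 1 s = max 0 (3 - s)"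
  using sys sieve_vanishes[of 1 s] by (cases "s \<le> 3") (simp_all add: sieve_system_def)

lemma sieve_deriv:
  assumes "n \<ge> 1" "kink (Suc n) \<le> s"
  shows "((\<lambda>u. u * f (Suc n) u) has_real_derivative - f n (s - 1)) (at s within {kink (Suc n)..})"
  using sieve_system_upper[OF sys, of "Suc n" s] assms by (simp add: kink_def)

lemma sieve_const:
  assumes "n \<ge> 2" "odd n" "1 \<le> s" "s \<le> 3"
  shows "s * f n s = 3 * f n 3"
proof -
  have "\<exists>C. \<forall>x\<in>{1..3}. x * f n x = C"
    by (intro has_field_derivative_zero_constant sieve_system_lower[OF sys]) (use assms in auto)
  then show ?thesis using assms by force
qed

lemma sieve_mvt:
  assumes "n \<ge> 1" "kink (Suc n) \<le> s" "s < t"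
  obtains v where "s < v" "v < t" "s * f (Suc n) s - t * f (Suc n) t = (t - s) * f n (v - 1)"
proof -
  obtain v where "s < v" "v < t" "t * f (Suc n) t - s * f (Suc n) s = - f n (v - 1) * (t - s)"
    by (rule mvt_within[of s t "{kink (Suc n)..}" "\<lambda>u. u * f (Suc n) u" "\<lambda>v. - f n (v - 1)"])
      (use assms in \<open>auto intro!: sieve_deriv\<close>)
  then show thesis using that[of v] by (simp add: algebra_simps)
qed

text \<open>Both facts go through one induction: \<open>f n \<ge> 0\<close> makes
  \<open>s * f (Suc n) s\<close> decreasing, and since this vanishes for large \<open>s\<close>, it
  is nonnegative.\<close>

lemma sieve_nonneg_antimono:
  assumes "n \<ge> 1" "left_end n \<le> s" "s \<le> t"
  shows "0 \<le> f n t" "t * f n t \<le> s * f n s"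
proof -
  have "\<forall>s t. left_end n \<le> s \<longrightarrow> s \<le> t \<longrightarrow> 0 \<le> f n t \<and> t * f n t \<le> s * f n s"
    using \<open>n \<ge> 1\<close>
  proof (induction n rule: dec_induct)
    case base
    show ?case
    proof (intro allI impI)
      fix s t :: real assume st: "left_end 1 \<le> s" "s \<le> t"
      then have "1 \<le> s" "1 \<le> t" by (auto simp: left_end_def)
      moreover from this have "0 \<le> t * f 1 t" using sieve_first[of t] by simp
      ultimately show "0 \<le> f 1 t \<and> t * f 1 t \<le> s * f 1 s"
        using st sieve_first[of s] sieve_first[of t] by (simp add: zero_le_mult_iff)
    qed
  next
    case (step n)
    have mono: "t * f (Suc n) t \<le> s * f (Suc n) s" if "kink (Suc n) \<le> s" "s \<le> t" for s t
    proof (cases "s = t")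
      case False
      with that have "s < t" by simp
      from sieve_mvt[OF _ that(1) this] step.hyps obtain v where
        v: "s < v" "s * f (Suc n) s - t * f (Suc n) t = (t - s) * f n (v - 1)" by auto
      have "0 \<le> f n (v - 1)"
        using step.IH left_end_le_kink_Suc[of n] v that by force
      then have "0 \<le> (t - s) * f n (v - 1)" using that by simp
      with v show ?thesis by simp
    qed simp
    have const: "s * f (Suc n) s = 3 * f (Suc n) 3" if "left_end (Suc n) \<le> s" "s < kink (Suc n)" for s
      using that step.hyps by (intro sieve_const) (auto simp: left_end_def kink_def split: if_splits)
    have kink3: "kink (Suc n) = 3" if "left_end (Suc n) \<le> s" "s < kink (Suc n)" for s
      using that by (auto simp: left_end_def kink_def split: if_splits)
    have mono': "t * f (Suc n) t \<le> s * f (Suc n) s" if "left_end (Suc n) \<le> s" "s \<le> t" for s t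
      using mono[of s t] mono[of 3 t] const[of s] const[of t] kink3[of s] that by force
    have "0 \<le> f (Suc n) t" if "left_end (Suc n) \<le> t" for t
    proof -
      have "max t (real n + 3) * f (Suc n) (max t (real n + 3)) \<le> t * f (Suc n) t"
        by (intro mono' that) simp
      moreover have "f (Suc n) (max t (real n + 3)) = 0" by (intro sieve_vanishes) auto
      ultimately have "0 \<le> t * f (Suc n) t" by simp
      with that left_end_pos[of "Suc n"] show ?thesis by (simp add: zero_le_mult_iff)
    qed
    with mono' show ?case by force
  qed
  with assms(2,3) show "0 \<le> f n t" "t * f n t \<le> s * f n s" by blast+
qed

lemma sieve_nonneg: "n \<ge> 1 \<Longrightarrow> left_end n \<le> s \<Longrightarrow> 0 \<le> f n s"
  using sieve_nonneg_antimono(1)[of n s s] by simp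

lemma sieve_antimono:
  assumes "n \<ge> 1" "left_end n \<le> s" "s \<le> t"
  shows "f n t \<le> f n s"
proof -
  have "0 < s" using assms left_end_pos[of n] by simp
  have "s * f n t \<le> t * f n t"
    using assms sieve_nonneg[of n t] by (intro mult_right_mono) auto
  also have "\<dots> \<le> s * f n s" by (rule sieve_nonneg_antimono(2)[OF assms])
  finally show ?thesis using \<open>0 < s\<close> by simp
qed

lemma sieve_times_convex:
  assumes "n \<ge> 2"
  shows "convex_on {kink n..} (\<lambda>u. u * f n u)"
proof -
  obtain m where m: "n = Suc m" "m \<ge> 1" using assms by (cases n) auto
  show ?thesis unfolding m(1)
  proof (rule convex_on_antimono_minus_derivative[where q = "\<lambda>s. f m (s - 1)"])
    show "antimono_on {kink (Suc m)..} (\<lambda>s. f m (s - 1))"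
      using left_end_le_kink_Suc[of m] m
      by (intro monotone_onI sieve_antimono) auto
  qed (rule sieve_deriv[OF m(2)])
qed

text \<open>\<open>f n u\<close> is the product of \<open>u * f n u\<close> and
  \<open>inverse u\<close>, both nonnegative, decreasing and convex.\<close>

lemma sieve_convex_of_times_convex:
  assumes "n \<ge> 1" "S \<subseteq> {left_end n..}" "convex_on S (\<lambda>u. u * f n u)"
  shows "convex_on S (f n)"
proof -
  have pos: "0 < u" if "u \<in> S" for u using that assms(2) left_end_pos[of n] by force
  have "convex_on S (\<lambda>u. (u * f n u) * inverse u)"
  proof (rule convex_on_mul_antimono)
    show "convex_on S (inverse :: real \<Rightarrow> real)"
      by (rule convex_on_inverse) (use pos assms(3) convex_on_imp_convex in auto)
    show "antimono_on S (\<lambda>u. u * f n u)"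
      using assms by (intro monotone_onI sieve_nonneg_antimono(2)) auto
    show "antimono_on S (inverse :: real \<Rightarrow> real)"
      using pos by (intro monotone_onI) (auto intro: le_imp_inverse_le)
    show "0 \<le> u * f n u" if "u \<in> S" for u
      using that assms pos[OF that] by (intro mult_nonneg_nonneg sieve_nonneg) auto
    show "0 \<le> inverse u" if "u \<in> S" for u using pos[OF that] by simp
  qed (fact assms)
  then show ?thesis by (rule convex_on_transform) (use pos in force)
qed

text \<open>For odd \<open>n \<ge> 3\<close> the slope of \<open>u * f n u\<close> may drop at 3, so
  the cell must lie on one side of 3. To the left of 3, \<open>u * f n u\<close> is affine for every
  odd \<open>n\<close>.\<close>

lemma sieve_convex_cell:
  assumes "n \<ge> 1" "left_end n \<le> x" "x \<le> y" "y \<le> 3 \<or> kink n \<le> x"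
  shows "convex_on {x..y} (f n)"
proof (rule sieve_convex_of_times_convex)
  show "convex_on {x..y} (\<lambda>u. u * f n u)"
  proof (cases "n \<ge> 2 \<and> kink n \<le> x")
    case True
    then show ?thesis
      by (intro convex_on_subset[OF sieve_times_convex]) auto
  next
    case False
    have "\<exists>a b. \<forall>u\<in>{x..y}. u * f n u = a + b * u"
    proof (cases "n = 1")
      case True
      then have "\<forall>u\<in>{x..y}. u * f n u = max 0 (3 - u)"
        using sieve_first assms(2) by (simp add: left_end_def)
      moreover have "y \<le> 3 \<or> 3 \<le> x" using assms(4) True by (simp add: kink_def)
      ultimately have "(\<forall>u\<in>{x..y}. u * f n u = 3 + (- 1) * u) \<or> (\<forall>u\<in>{x..y}. u * f n u = 0 + 0 * u)"
        by (auto simp del: mult_eq_0_iff)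
      then show ?thesis by blast
    next
      case n: False
      then have "odd n" "y \<le> 3" "1 \<le> x"
        using False assms by (auto simp: kink_def left_end_def split: if_splits)
      then have "\<forall>u\<in>{x..y}. u * f n u = 3 * f n 3 + 0 * u"
        using n assms(1) by (auto intro!: sieve_const)
      then show ?thesis by blast
    qed
    then obtain a b where "\<And>u. u \<in> {x..y} \<Longrightarrow> u * f n u = a + b * u" by blast
    moreover have "convex_on {x..y} (\<lambda>u. a + b * u)"
      by (intro convex_onI) (auto simp: algebra_simps)
    ultimately show ?thesis by (rule convex_on_transform[rotated])
  qed
qed (use assms in auto)

lemma sieve_trapezoid:
  assumes "n \<ge> 1" "kink (Suc n) \<le> x" "x < y" "y \<le> 4 \<or> kink n + 1 \<le> x"
  shows "x * f (Suc n) x \<le> y * f (Suc n) y + (y - x) / 2 * (f n (x - 1) + f n (y - 1))"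
proof (rule trapezoid_upper[where F = "\<lambda>u. u * f (Suc n) u"])
  show "convex_on {x - 1..y - 1} (f n)"
    using assms left_end_le_kink_Suc[of n] by (intro sieve_convex_cell) auto
  fix u assume "u \<in> {x..y}"
  then show "((\<lambda>u. u * f (Suc n) u) has_real_derivative - f n (u - 1)) (at u within {x..y})"
    by (intro DERIV_subset[OF sieve_deriv]) (use assms in auto)
qed fact

section \<open>Exponential decay\<close>

text \<open>The third assumption says exactly that \<open>f n\<close> plus its derivative is at most
  0 on \<open>{a..}\<close>. This sum, at \<open>s - 1\<close>, is the derivative of
  \<open>D\<close>, so \<open>D\<close> decreases to 0.\<close>

lemma sieve_le_previous_step:
  assumes "n \<ge> 2" "kink n \<le> a"
    and "\<And>u. a \<le> u \<Longrightarrow> (u - 1) * (u * f n u) \<le> u * f (n - 1) (u - 1)"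
    and "kink (Suc n) \<le> a + 1" "a + 1 \<le> s"
  shows "s * f (Suc n) s \<le> f n (s - 1)"
proof -
  obtain m where m: "n = Suc m" "m \<ge> 1" using assms by (cases n) auto
  define D where "D s = f n (s - 1) - s * f (Suc n) s" for s
  \<comment> \<open>A point beyond the supports of both terms of \<open>D\<close>.\<close>
  define t where "t = max s (real n + 3)"
  have "D t \<le> D s"
  \<comment> \<open>The fraction is the derivative of \<open>f n\<close> at \<open>v - 1\<close>,
    obtained by the quotient rule from \<open>w * f n w / w\<close>.\<close>
  proof (rule antimono_within[where F = D and x = s and y = t and S = "{a + 1..}" and F' = "\<lambda>v.
      (- f m (v - 1 - 1) * (v - 1) - (v - 1) * f n (v - 1) * 1) / ((v - 1) * (v - 1)) * 1 + f n (v - 1)"])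
    show "s \<le> t" by (simp add: t_def)
    fix v assume v: "v \<in> {s..t}"
    define u where "u = v - 1"
    have u: "a \<le> u" "1 < u" "u \<noteq> 0" "kink (Suc m) \<le> u"
      using v assms m by (auto simp: u_def kink_def split: if_splits)
    have "((\<lambda>u. u * f n u) has_real_derivative - f m (u - 1)) (at u within {a..})"
      using u assms m by (auto intro!: DERIV_subset[OF sieve_deriv])
    then have "((\<lambda>w. w * f n w / w) has_real_derivative
        (- f m (u - 1) * u - u * f n u * 1) / (u * u)) (at u within {a..})"
      using u by (intro DERIV_divide DERIV_ident) auto
    then have fu: "(f n has_real_derivative
        (- f m (u - 1) * u - u * f n u * 1) / (u * u)) (at u within {a..})"
      by (rule has_field_derivative_transform_within[where d = 1])
        (use u assms(1,2) in \<open>auto simp: kink_def split: if_splits\<close>)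
    have img: "(\<lambda>v. v - 1) ` {a + 1..} = {a..}"
      by (force intro: image_eqI[where x = "_ + 1"])
    have "(f n \<circ> (\<lambda>v. v - 1) has_real_derivative
        (- f m (u - 1) * u - u * f n u * 1) / (u * u) * 1) (at v within {a + 1..})"
    proof (rule DERIV_image_chain)
      show "((\<lambda>v. v - 1) has_real_derivative 1) (at v within {a + 1..})"
        by (auto intro!: derivative_eq_intros)
    qed (use fu img in \<open>simp add: u_def\<close>)
    then have "((\<lambda>v. f n (v - 1)) has_real_derivative
        (- f m (u - 1) * u - u * f n u * 1) / (u * u) * 1) (at v within {a + 1..})"
      by (simp only: o_def)
    moreover have "((\<lambda>u. u * f (Suc n) u) has_real_derivative - f n u) (at v within {a + 1..})"
      using v assms sieve_deriv[of n v] by (auto intro: DERIV_subset simp: u_def)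
    ultimately have "((\<lambda>v. f n (v - 1) - v * f (Suc n) v) has_real_derivative
        (- f m (u - 1) * u - u * f n u * 1) / (u * u) * 1 - - f n u) (at v within {a + 1..})"
      by (rule DERIV_diff)
    then show "(D has_real_derivative (- f m (v - 1 - 1) * (v - 1) - (v - 1) * f n (v - 1) * 1)
        / ((v - 1) * (v - 1)) * 1 + f n (v - 1)) (at v within {a + 1..})"
      by (simp add: D_def[abs_def] u_def)
    have "(u - 1) * (u * f n u) \<le> u * f m (u - 1)" using assms(3)[OF u(1)] m by simp
    moreover have "(- f m (u - 1) * u - u * f n u * 1) / (u * u) * 1 + f n u
        = ((u - 1) * (u * f n u) - u * f m (u - 1)) / (u * u)"
      using u by (simp add: field_simps)
    ultimately have "(- f m (u - 1) * u - u * f n u * 1) / (u * u) * 1 + f n u \<le> 0"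
      by (simp add: divide_nonpos_nonneg)
    then show "(- f m (v - 1 - 1) * (v - 1) - (v - 1) * f n (v - 1) * 1)
        / ((v - 1) * (v - 1)) * 1 + f n (v - 1) \<le> 0"
      by (simp only: u_def)
  qed (use assms in auto)
  moreover have "D t = 0"
    using sieve_vanishes[of n "t - 1"] sieve_vanishes[of "Suc n" t] assms(1) by (simp add: D_def t_def)
  ultimately show ?thesis by (simp add: D_def)
qed

text \<open>The start of the decay induction. By the mean value theorem
  \<open>u * f 2 u \<le> (4 - u) * f 1 (u - 1)\<close>, and \<open>(u - 1) * (4 - u) \<le> u\<close>
  is \<open>(u - 2)^2 \<ge> 0\<close>.\<close>

lemma sieve_ratio_two:
  assumes "2 \<le> u"
  shows "(u - 1) * (u * f 2 u) \<le> u * f 1 (u - 1)"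
proof (cases "u < 4")
  case True
  have f1: "f 1 s = (3 - s) / s" if "1 \<le> s" "s \<le> 3" for s
    using sieve_first[of s] that by (simp add: field_simps)
  obtain v where v: "u < v" "v < 4" "u * f 2 u - 4 * f 2 4 = (4 - u) * f 1 (v - 1)"
    using sieve_mvt[of 1 u 4] assms True by (auto simp: kink_def numeral_2_eq_2)
  have "f 1 (v - 1) \<le> f 1 (u - 1)"
    using assms v by (intro sieve_antimono) (auto simp: left_end_def)
  then have "u * f 2 u \<le> (4 - u) * f 1 (u - 1)"
    using v True sieve_vanishes[of 2 4] by (simp add: mult_left_mono)
  then have "(u - 1) * (u * f 2 u) \<le> (u - 1) * ((4 - u) * f 1 (u - 1))"
    using assms by (intro mult_left_mono) auto
  also have "\<dots> = ((u - 1) * (4 - u)) * f 1 (u - 1)" by simp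
  also have "\<dots> \<le> u * f 1 (u - 1)"
  proof (rule mult_right_mono)
    have "0 \<le> (u - 2)\<^sup>2" by simp
    then show "(u - 1) * (4 - u) \<le> u" by (simp add: power2_eq_square algebra_simps)
    show "0 \<le> f 1 (u - 1)" using assms by (intro sieve_nonneg) (auto simp: left_end_def)
  qed
  finally show ?thesis .
next
  case False
  then show ?thesis
    using sieve_vanishes[of 2 u] sieve_nonneg[of 1 "u - 1"] by (simp add: left_end_def)
qed

text \<open>On [1, 3], \<open>f n s = C / s\<close>, so the equation integrates on [2, 4] to
  \<open>u * f (Suc n) u = 4 * f (Suc n) 4 + C * ln (3 / (u - 1))\<close>. The assumption
  \<open>four\<close> bounds the first term by \<open>C / 3\<close>.\<close>

lemma sieve_ratio_even_left:
  assumes "n \<ge> 3" "odd n" "2 \<le> u" "u \<le> 4" and four: "4 * f (Suc n) 4 \<le> f n 3"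
  shows "(u - 1) * (u * f (Suc n) u) \<le> u * f n (u - 1)"
proof -
  define C where "C = 3 * f n 3"
  have fn: "f n s = C / s" if "1 \<le> s" "s \<le> 3" for s
    using sieve_const[of n s] that assms by (simp add: C_def field_simps)
  have "C \<ge> 0" using sieve_nonneg[of n 3] assms by (simp add: C_def left_end_def)
  have "u * f (Suc n) u + C * ln (u - 1) \<le> 4 * f (Suc n) 4 + C * ln (4 - 1)"
  proof -
    have "\<exists>K. \<forall>v\<in>{2..4}. v * f (Suc n) v + C * ln (v - 1) = K"
    proof (intro has_field_derivative_zero_constant)
      fix v :: real assume v: "v \<in> {2..4}"
      have F: "((\<lambda>u. u * f (Suc n) u) has_real_derivative - f n (v - 1)) (at v within {2..4})"
        by (rule DERIV_subset[OF sieve_deriv]) (use v assms in \<open>auto simp: kink_def\<close>)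
      have L: "((\<lambda>u. C * ln (u - 1)) has_real_derivative C * (1 / (v - 1))) (at v within {2..4})"
        using v by (auto intro!: derivative_eq_intros)
      have "- f n (v - 1) + C * (1 / (v - 1)) = 0" using v by (simp add: fn)
      with DERIV_add[OF F L] show "((\<lambda>v. v * f (Suc n) v + C * ln (v - 1)) has_real_derivative 0)
          (at v within {2..4})"
        by simp
    qed simp
    then obtain K where K: "\<forall>v\<in>{2..4}. v * f (Suc n) v + C * ln (v - 1) = K" by blast
    have "u * f (Suc n) u + C * ln (u - 1) = K" "4 * f (Suc n) 4 + C * ln (4 - 1) = K"
      by (rule bspec[OF K]; use assms in simp)+
    then show ?thesis by linarith
  qed
  then have "u * f (Suc n) u \<le> C / 3 + C * (ln 3 - ln (u - 1))"
    using four by (simp add: C_def algebra_simps)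
  also have "\<dots> = C * (1 / 3 + ln (3 / (u - 1)))"
    using assms by (simp add: ln_div algebra_simps)
  finally have "(u - 1)\<^sup>2 * (u * f (Suc n) u) \<le> (u - 1)\<^sup>2 * (C * (1 / 3 + ln (3 / (u - 1))))"
    by (intro mult_left_mono) auto
  also have "\<dots> = C * ((u - 1)\<^sup>2 * (1 / 3 + ln (3 / (u - 1))))" by simp
  also have "\<dots> \<le> C * u"
    using square_times_log_le[of "u - 1"] assms \<open>C \<ge> 0\<close> by (intro mult_left_mono) auto
  also have "C * u = (u - 1) * (u * f n (u - 1))" using assms by (simp add: fn)
  finally have "(u - 1) * ((u - 1) * (u * f (Suc n) u)) \<le> (u - 1) * (u * f n (u - 1))"
    by (simp add: power2_eq_square mult.assoc)
  then show ?thesis using assms by simp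
qed

text \<open>Equivalently, the derivative of \<open>f n\<close> is at most \<open>- f n\<close>:
  decay at least as fast as \<open>exp (- u)\<close>.\<close>

lemma sieve_ratio:
  assumes "n \<ge> 2" "kink n \<le> u"
  shows "(u - 1) * (u * f n u) \<le> u * f (n - 1) (u - 1)"
proof -
  have weak: "(u - 1) * (u * f (Suc n) u) \<le> u * f n (u - 1)"
    if "u * f (Suc n) u \<le> f n (u - 1)" "2 \<le> u" "n \<ge> 1" for n u
  proof -
    have "0 \<le> u * f (Suc n) u"
      using that sieve_nonneg[of "Suc n" u] by (simp add: left_end_def)
    then have "(u - 1) * (u * f (Suc n) u) \<le> u * (u * f (Suc n) u)"
      by (intro mult_right_mono) auto
    also have "\<dots> \<le> u * f n (u - 1)" using that by (intro mult_left_mono) auto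
    finally show ?thesis .
  qed
  have "\<forall>u\<ge>kink n. (u - 1) * (u * f n u) \<le> u * f (n - 1) (u - 1)"
    using assms(1)
  proof (induction n rule: dec_induct)
    case base
    then show ?case using sieve_ratio_two by (simp add: kink_def)
  next
    case (step n)
    have prev: "s * f (Suc n) s \<le> f n (s - 1)" if "kink n + 1 \<le> s" for s
      by (rule sieve_le_previous_step[of n "kink n"]) (use step that in \<open>auto simp: kink_def\<close>)
    show ?case
    proof (intro allI impI)
      fix u assume u: "kink (Suc n) \<le> u"
      show "(u - 1) * (u * f (Suc n) u) \<le> u * f (Suc n - 1) (u - 1)"
      proof (cases "kink n + 1 \<le> u")
        case True
        then show ?thesis using weak[OF prev[OF True]] u step.hyps by (auto simp: kink_def split: if_splits)
      next
        case False
        \<comment> \<open>Only odd \<open>n\<close> leaves a gap: then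
          \<open>kink (Suc n) = 2\<close>, while \<open>prev\<close> starts at
          \<open>kink n + 1 = 4\<close>.\<close>
        then have "odd n" "2 \<le> u" "u \<le> 4" using u by (auto simp: kink_def split: if_splits)
        moreover have "n \<ge> 3" using \<open>odd n\<close> step.hyps by (cases "n = 2") auto
        ultimately show ?thesis
          using sieve_ratio_even_left[of n u] prev[of 4] by (simp add: kink_def)
      qed
    qed
  qed
  with assms(2) show ?thesis by blast
qed

lemma sieve_le_previous:
  assumes "n \<ge> 2" "kink n + 1 \<le> s"
  shows "s * f (Suc n) s \<le> f n (s - 1)"
  by (rule sieve_le_previous_step[of n "kink n"])
    (use assms sieve_ratio in \<open>auto simp: kink_def\<close>)

lemma sieve_exp_antimono:
  assumes "n \<ge> 2" "kink n + 1 \<le> s" "s \<le> t"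
  shows "t * f (Suc n) t * exp t \<le> s * f (Suc n) s * exp s"
proof (rule antimono_within[where F = "\<lambda>u. u * f (Suc n) u * exp u" and S = "{s..t}"
      and F' = "\<lambda>u. - f n (u - 1) * exp u + exp u * (u * f (Suc n) u)"])
  fix u assume u: "u \<in> {s..t}"
  have "((\<lambda>u. u * f (Suc n) u) has_real_derivative - f n (u - 1)) (at u within {s..t})"
    by (rule DERIV_subset[OF sieve_deriv]) (use u assms in \<open>auto simp: kink_def split: if_splits\<close>)
  then show "((\<lambda>u. u * f (Suc n) u * exp u) has_real_derivative
      - f n (u - 1) * exp u + exp u * (u * f (Suc n) u)) (at u within {s..t})"
    by (rule DERIV_mult) (auto intro!: derivative_eq_intros)
  have "u * f (Suc n) u \<le> f n (u - 1)"
    using u assms by (intro sieve_le_previous) auto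
  then show "- f n (u - 1) * exp u + exp u * (u * f (Suc n) u) \<le> 0"
    by (simp add: mult.commute)
qed (use assms in auto)

section \<open>Reduction of the comparison with \<open>h\<close> to a few values\<close>

text \<open>For \<open>s \<ge> 3\<close> the claim reads
  \<open>s * f (Suc n) s * exp s \<le> 6 * exp 2 * k\<close>, and its left side decreases in
  \<open>s\<close>.\<close>

lemma sieve_bound_tail:
  assumes "n \<ge> 2" "kink n + 1 \<le> a" "a \<le> s" "a \<ge> 3"
    and "a * f (Suc n) a * exp a \<le> 6 * exp 2 * k"
  shows "f (Suc n) s \<le> 2 * (exp 1)\<^sup>2 * k * h s"
proof -
  have s: "0 < s" using assms by simp
  have "s * f (Suc n) s * exp s \<le> 6 * exp 2 * k"
    using sieve_exp_antimono[OF assms(1-3)] assms(5) by simp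
  then have "f (Suc n) s \<le> 6 * exp 2 * k / (s * exp s)"
    using s by (simp add: field_simps)
  also have "\<dots> \<le> 2 * (exp 1)\<^sup>2 * k * (3 / s * exp (- s))"
    by (simp add: exp_one_squared exp_minus field_simps)
  also have "3 / s * exp (- s) = h s"
    using assms by (cases "s = 3") (auto simp: h_def)
  finally show ?thesis .
qed

text \<open>Since \<open>s * f n s\<close> is constant on [1, 3], its value at 3 controls that
  interval; with \<open>exp 1 \<le> 3\<close> it also starts the tail bound.\<close>

lemma sieve_bound_odd:
  assumes "n \<ge> 3" "odd n" "1 \<le> s" and three: "3 * f n 3 \<le> 2 * k"
  shows "f n s \<le> 2 * (exp 1)\<^sup>2 * k * h s"
proof -
  have "0 \<le> f n 3" using assms by (intro sieve_nonneg) (auto simp: left_end_def)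
  then have "0 \<le> k" using three by simp
  consider "s \<le> 2" | "2 < s" "s \<le> 3" | "3 < s" by linarith
  then show ?thesis
  proof cases
    case 1
    have "1 * f n s \<le> s * f n s"
      using assms by (intro mult_right_mono sieve_nonneg) (auto simp: left_end_def)
    then have "f n s \<le> 2 * k" using sieve_const[of n s] 1 assms by simp
    with 1 show ?thesis by (simp add: h_def exp_one_squared exp_minus field_simps)
  next
    case 2
    then have "f n s \<le> 2 * k * (1 / s)"
      using sieve_const[of n s] assms by (simp add: field_simps)
    also have "\<dots> \<le> 2 * k * (exp 2 * exp (- s))"
      using exp_minus_two_ge(1)[of s] 2 \<open>0 \<le> k\<close> by (intro mult_left_mono) auto
    finally show ?thesis using 2 by (simp add: h_def exp_one_squared mult_ac)
  next
    case 3
    obtain m where m: "n = Suc m" "m \<ge> 2" "even m" using assms by (cases n) auto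
    have "3 * f n 3 * exp 3 \<le> 2 * k * (exp 1 * exp 2)"
      using three by (simp flip: exp_add)
    also have "\<dots> \<le> 2 * k * (3 * exp 2)"
      using exp_le_two_72 \<open>0 \<le> k\<close> by (intro mult_left_mono mult_right_mono) auto
    finally show ?thesis
      using sieve_bound_tail[of m 3 s k] m 3 by (simp add: kink_def mult.commute)
  qed
qed

text \<open>The thresholds \<open>4 * k\<close>, \<open>2 * k\<close>, \<open>2 / 3 * k\<close> are
  chosen so that the chords \<open>2 * k * (4 - s)\<close> and
  \<open>2 * k * (3 - 2 * s / 3)\<close> stay below \<open>s\<close> times the right side. The
  threshold at 2 is exactly what the claim demands there.\<close>

lemma sieve_bound_even:
  assumes "n \<ge> 2" "even n" "2 \<le> s"
    and two: "2 * f n 2 \<le> 4 * k" and three: "3 * f n 3 \<le> 2 * k" and four: "4 * f n 4 \<le> 2 / 3 * k"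
  shows "f n s \<le> 2 * (exp 1)\<^sup>2 * k * h s"
proof -
  have "0 \<le> f n 3" using assms by (intro sieve_nonneg) (auto simp: left_end_def)
  then have "0 \<le> k" using three by simp
  have cvx: "convex_on {2..} (\<lambda>u. u * f n u)"
    using sieve_times_convex[of n] assms by (simp add: kink_def)
  have chord: "s * f n s \<le> (b * f n b - a * f n a) / (b - a) * (s - a) + a * f n a"
    if "2 \<le> a" "a \<le> s" "s \<le> b" for a b
    by (rule convex_onD_Icc'[OF convex_on_subset[OF cvx]]) (use that in auto)
  consider "s = 2" | "2 < s" "s \<le> 3" | "3 < s" "s \<le> 4" | "4 < s" using assms by linarith
  then show ?thesis
  proof cases
    case 1
    with two show ?thesis by (simp add: h_def exp_one_squared exp_minus field_simps)
  next
    case 2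
    have "s * f n s \<le> (3 * f n 3) * (s - 2) + (2 * f n 2) * (3 - s)"
      using chord[of 2 3] 2 by (simp add: algebra_simps)
    also have "\<dots> \<le> (2 * k) * (s - 2) + (4 * k) * (3 - s)"
      using two three 2 by (intro add_mono mult_right_mono) auto
    also have "\<dots> = 2 * k * (4 - s)" by (simp add: algebra_simps)
    also have "\<dots> \<le> 2 * k * (exp 2 * exp (- s) * s)"
      using exp_minus_two_ge(2)[of s] 2 \<open>0 \<le> k\<close> by (intro mult_left_mono) auto
    also have "\<dots> = s * (2 * exp 2 * k * exp (- s))" by simp
    finally show ?thesis using 2 by (simp add: h_def exp_one_squared)
  next
    case 3
    have "s * f n s \<le> (4 * f n 4) * (s - 3) + (3 * f n 3) * (4 - s)"
      using chord[of 3 4] 3 by (simp add: algebra_simps)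
    also have "\<dots> \<le> (2 / 3 * k) * (s - 3) + (2 * k) * (4 - s)"
      using four three 3 by (intro add_mono mult_right_mono) auto
    also have "\<dots> = 2 * k * (3 - 2 * s / 3)" by (simp add: field_simps)
    also have "\<dots> \<le> 2 * k * (3 * (exp 2 * exp (- s)))"
      using exp_minus_tangent[of s] 3 \<open>0 \<le> k\<close> by (intro mult_left_mono) auto
    also have "\<dots> = s * (2 * exp 2 * k * (3 / s * exp (- s)))" using 3 by simp
    finally have "f n s \<le> 2 * exp 2 * k * (3 / s * exp (- s))"
      by (rule mult_left_le_imp_le) (use 3 in simp)
    then show ?thesis using 3 by (simp add: h_def exp_one_squared)
  next
    case 4
    show ?thesis
    \<comment> \<open>The tail bound covers only indices from 3 on, but \<open>f 2\<close> vanishes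
      on [4, \<infinity>).\<close>
    proof (cases "n = 2")
      case True
      then show ?thesis using sieve_vanishes[of 2 s] 4 \<open>0 \<le> k\<close> by (simp add: h_def)
    next
      case False
      then obtain m where m: "n = Suc m" "m \<ge> 2" "odd m" using assms by (cases n) auto
      have "exp 4 = exp 2 * (exp 1 :: real)\<^sup>2" by (simp add: exp_one_squared flip: exp_add)
      also have "\<dots> \<le> exp 2 * 3\<^sup>2"
        using exp_le_two_72 by (intro mult_left_mono power_mono) auto
      finally have "2 / 3 * k * exp 4 \<le> 2 / 3 * k * (exp 2 * 3\<^sup>2)"
        using \<open>0 \<le> k\<close> by (intro mult_left_mono) auto
      moreover have "4 * f n 4 * exp 4 \<le> 2 / 3 * k * exp 4"
        using four by (rule mult_right_mono) simp
      ultimately have "4 * f n 4 * exp 4 \<le> 2 / 3 * k * (exp 2 * 3\<^sup>2)" by linarith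
      then show ?thesis
        using sieve_bound_tail[of m 4 s k] m 4 by (simp add: kink_def mult.commute)
    qed
  qed
qed

end

subsection \<open>Upper bounds on a grid\<close>

text \<open>Running sums from the right: each trapezoid is added to the bound at the next grid
  point.\<close>

fun add_hd :: "int \<Rightarrow> int list \<Rightarrow> int list" where
  "add_hd x [] = []"
| "add_hd x (y # ys) = (x + y) # y # ys"

text \<open>The list argument holds bounds for \<open>s * f n s\<close> at \<open>s = i / 16, (i + 1) / 16, \<dots>, 8\<close>; the result
  holds bounds for \<open>s * f (n + 1) s\<close> at \<open>s = (i + 16) / 16, \<dots>, 8\<close>. Each summand is a trapezoid of width
  1/16, rounded up; at \<open>i = 112\<close> the bound \<open>8 * f (n + 1) 8 \<le> f n 7\<close> enters.\<close>

fun grid_sums :: "int \<Rightarrow> int list \<Rightarrow> int list" where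
  "grid_sums i (a # b # L) =
     (if i = 112 then [a div 7 + 1]
      else add_hd (((i + 1) * a + i * b) div (2 * i * (i + 1)) + 1) (grid_sums (i + 1) (b # L)))"
| "grid_sums i [a] = []"
| "grid_sums i [] = []"

text \<open>For odd indices from 3 on, the 32 grid points in [1, 3) inherit the bound at 3.\<close>

fun prepend_const :: "int list \<Rightarrow> int list" where
  "prepend_const [] = []"
| "prepend_const (a # L) = replicate 32 a @ a # L"

text \<open>The flag \<open>e\<close> says whether the new index is even; summation then begins at
  the point 1 of the old grid, otherwise at 2, giving new bounds from 2 or 3 on.\<close>

definition grid_step :: "bool \<Rightarrow> int list \<Rightarrow> int list" where
  "grid_step e L = (if e then grid_sums 16 L else prepend_const (grid_sums 32 L))"

text \<open>The list \<open>grid n\<close> belongs to \<open>f (n + 1)\<close>, scaled by \<open>10 ^ 14\<close>. It starts at \<open>s = 1\<close> if \<open>n + 1\<close> is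
  odd and at \<open>s = 2\<close> otherwise.\<close>

primrec grid :: "nat \<Rightarrow> int list" where
  "grid 0 = map (\<lambda>i. max 0 (48 - i) * 6250000000000) [16..128]"
| "grid (Suc n) = grid_step (even n) (grid n)"

text \<open>\<open>A\<close> is the unit of the integer bounds. It is kept variable so that one list
  can serve many \<open>n\<close> with ever smaller units.\<close>

primrec dominates :: "real \<Rightarrow> (real \<Rightarrow> real) \<Rightarrow> int \<Rightarrow> int list \<Rightarrow> bool" where
  "dominates A g i [] = True"
| "dominates A g i (a # L) = (g (of_int i / 16) \<le> A * of_int a \<and> dominates A g (i + 1) L)"

lemma dominates_nth:
  "dominates A g i L \<Longrightarrow> k < length L \<Longrightarrow> g ((of_int i + of_nat k) / 16) \<le> A * of_int (L ! k)"
proof (induction L arbitrary: i k)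
  case (Cons a L)
  then show ?case by (cases k) (fastforce simp: add_ac)+
qed simp

lemma dominates_map_upto:
  assumes "\<And>j. i \<le> j \<Longrightarrow> j \<le> k \<Longrightarrow> g (of_int j / 16) \<le> A * of_int (p j)"
  shows "dominates A g i (map p [i..k])"
  using assms
proof (induction i k rule: upto.induct)
  case (1 i k)
  then show ?case by (subst upto.simps) auto
qed

lemma dominates_replicate_append:
  assumes "\<And>j. i \<le> j \<Longrightarrow> j < i + int m \<Longrightarrow> g (of_int j / 16) \<le> A * of_int a"
    and "dominates A g (i + int m) L"
  shows "dominates A g i (replicate m a @ L)"
  using assms by (induction m arbitrary: i) (auto simp: add_ac)

lemma dominates_contract:
  assumes "list_all2 (\<lambda>a b. 10000 * b \<le> 5234 * a) L M" "dominates A g i M" "0 \<le> A"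
  shows "dominates (A * (5234 / 10000)) g i L"
  using assms(1,2)
proof (induction arbitrary: i rule: list_all2_induct)
  case (Cons a L b M)
  have "real_of_int b \<le> 5234 / 10000 * of_int a" using Cons.hyps(1) by linarith
  then have "A * of_int b \<le> A * (5234 / 10000 * of_int a)" using assms(3) by (rule mult_left_mono)
  then show ?case using Cons by simp
qed simp

lemma of_int_le_div_plus_one:
  fixes a q :: int
  assumes "0 < q"
  shows "real_of_int a / of_int q \<le> of_int (a div q + 1)"
proof -
  have "a \<le> (a div q + 1) * q" using assms
    by (metis add.commute distrib_right div_mult_mod_eq mult_1 pos_mod_bound add_le_cancel_left less_imp_le)
  then have "real_of_int a \<le> of_int (a div q + 1) * of_int q"
    by (metis of_int_le_iff of_int_mult)
  then show ?thesis using assms by (simp add: pos_divide_le_eq)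
qed

text \<open>With \<open>g s = s * f n s\<close>, the value \<open>f n (j / 16)\<close> is
  \<open>16 * g (j / 16) / j\<close>, so a trapezoid of width 1/16 has the area written in
  \<open>cell\<close>. Its integer bound is \<open>div\<close> plus one.\<close>

lemma dominates_grid_sums:
  assumes A: "0 \<le> A" and i: "1 \<le> i" "i \<le> 112"
    and cell: "\<And>j. i \<le> j \<Longrightarrow> j < 112 \<Longrightarrow> G (of_int (j + 16) / 16) \<le> G (of_int (j + 17) / 16)
        + (g (of_int j / 16) / of_int j + g (of_int (j + 1) / 16) / of_int (j + 1)) / 2"
    and last: "G 8 \<le> g 7 / 7"
    and "dominates A g i L"
  shows "dominates A G (i + 16) (grid_sums i L)"
  using i cell \<open>dominates A g i L\<close>
proof (induction i L rule: grid_sums.induct)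
  case (1 i a b L)
  show ?case
  proof (cases "i = 112")
    case True
    have "G 8 \<le> A * of_int a / 7" using last 1 True by simp
    also have "\<dots> = A * (of_int a / of_int 7)" by simp
    also have "\<dots> \<le> A * of_int (a div 7 + 1)"
      using A by (intro mult_left_mono of_int_le_div_plus_one) auto
    finally show ?thesis using True by simp
  next
    case False
    then have i: "1 \<le> i" "i < 112" using 1 by auto
    have IH: "dominates A G (i + 1 + 16) (grid_sums (i + 1) (b # L))"
      by (rule "1.IH") (use False i 1 in auto)
    show ?thesis
    proof (cases "grid_sums (i + 1) (b # L)")
      case Nil
      then show ?thesis using False by simp
    next
      case (Cons y ys)
      let ?q = "((i + 1) * a + i * b) div (2 * i * (i + 1)) + 1"
      have y: "G (of_int (i + 17) / 16) \<le> A * of_int y" using IH Cons by (simp add: add_ac)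
      have ab: "g (of_int i / 16) \<le> A * of_int a" "g (of_int (i + 1) / 16) \<le> A * of_int b"
        using 1 by simp_all
      have "(g (of_int i / 16) / of_int i + g (of_int (i + 1) / 16) / of_int (i + 1)) / 2
          \<le> (A * of_int a / of_int i + A * of_int b / of_int (i + 1)) / 2"
        using i ab by (intro divide_right_mono add_mono) auto
      also have "\<dots> = A * (of_int ((i + 1) * a + i * b) / of_int (2 * i * (i + 1)))"
        using i by (simp add: field_simps)
      also have "\<dots> \<le> A * of_int ?q"
        using A i by (intro mult_left_mono of_int_le_div_plus_one) auto
      finally have "G (of_int (i + 16) / 16) \<le> A * of_int y + A * of_int ?q"
        using "1.prems"(3)[of i] i y by linarith
      then have "G (of_int (i + 16) / 16) \<le> A * of_int (?q + y)" by (simp add: algebra_simps)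
      then show ?thesis using False Cons IH by (simp add: add_ac)
    qed
  qed
qed simp_all

text \<open>Positions 0, 16 and 32 of a list starting at \<open>s = 2\<close> belong to \<open>s = 2, 3, 4\<close>.\<close>

definition bounded_by :: "bool \<Rightarrow> int \<Rightarrow> int list \<Rightarrow> bool" where
  "bounded_by e b L \<longleftrightarrow> 32 < length L \<and> hd L \<le> b * 10 ^ 7 \<and>
     (e \<longrightarrow> 2 * L ! 16 \<le> hd L \<and> 6 * L ! 32 \<le> hd L)"

text \<open>The exact asymptotic growth factor over two steps is about 0.52239.\<close>

definition contracts :: "int list \<Rightarrow> int list \<Rightarrow> bool" where
  "contracts L M \<longleftrightarrow> list_all2 (\<lambda>a b. 10000 * b \<le> 5234 * a) L M"

text \<open>The current list is passed along, so that evaluation never restarts from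
  \<open>grid 0\<close>. The contraction test takes place at the last but one bound.\<close>

fun verified :: "bool \<Rightarrow> int list \<Rightarrow> int list \<Rightarrow> bool" where
  "verified e [] L \<longleftrightarrow> True"
| "verified e (b # bs) L \<longleftrightarrow> bounded_by e b L \<and>
     (if length bs = 1 then contracts L (grid_step e (grid_step (\<not> e) L)) else True) \<and>
     verified (\<not> e) bs (grid_step (\<not> e) L)"

lemma verified_grid:
  assumes "verified (odd n) bs (grid n)"
  shows "k < length bs \<Longrightarrow> bounded_by (odd (n + k)) (bs ! k) (grid (n + k))"
    and "length bs = k + 2 \<Longrightarrow> contracts (grid (n + k)) (grid (n + k + 2))"
  using assms
proof (induction bs arbitrary: n k)
  case (Cons b bs)
  {
    case 1
    then show ?case using Cons.IH(1)[of "k - 1" "Suc n"] by (cases k) auto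
  next
    case 2
    then show ?case using Cons.IH(2)[of "k - 1" "Suc n"] by (cases k) auto
  }
qed simp_all

text \<open>Rounded values of \<open>hd (grid (k + 1)) / 10 ^ 7\<close> for \<open>k = 0, \<dots>, 25\<close>.\<close>

definition start_bounds :: "int list" where
  "start_bounds = [12967046, 2942475, 3587073, 1318439, 1689574, 662584, 859069, 342444, 445483,
     178448, 232389, 93236, 121463, 48758, 63528, 25507, 33234, 13345, 17388, 6982, 9097, 3653,
     4760, 1912, 2491, 1000]"

lemma grid_26: "grid 26 = grid_step False (grid 25)"
  and grid_27: "grid 27 = grid_step True (grid_step False (grid 25))"
  using grid.simps(2)[of 25] grid.simps(2)[of 26] by simp_all

text \<open>The whole numerical check, by evaluation: bounds for \<open>f 2\<close> to
  \<open>f 27\<close>, and the contraction from \<open>f 26\<close> to \<open>f 28\<close>.\<close>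

lemma verified_start: "verified True start_bounds (grid 1)"
  by code_simp

section \<open>Comparison with the table of constants\<close>

text \<open>0.0002491 is the start bound for \<open>n = 26\<close>, and the cases are the ranges of
  \<open>c\<close>. In each, \<open>q\<close> is at least \<open>0.5234 / w^2\<close>; up to
  \<open>w = 0.72\<close> it exceeds 1, which makes the last \<open>k\<close> of the range decisive,
  whereas for 0.73 it can be 1.\<close>

lemma geometric_bound_even:
  assumes "26 + 2 * k \<le> 450"
  shows "(5234 / 10000) ^ k * 0.0002491 \<le> 4 * c (26 + 2 * k) ^ (25 + 2 * k)"
proof -
  consider "k \<le> 3" | "4 \<le> k" "k \<le> 10" | "11 \<le> k" "k \<le> 27" | "28 \<le> k" "k \<le> 141" | "142 \<le> k"
    by linarith
  then show ?thesis
  proof cases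
    case 1
    then have c: "c (26 + 2 * k) = 0.69" using assms by (auto simp: c_def)
    show ?thesis unfolding c
      by (rule geometric_bound[of "0.69" "5234 / 10000" "1.099349" 3 "1.3287" k 1 "0.0002491" 4 25])
        (use 1 assms in \<open>simp_all add: power_divide\<close>)
  next
    case 2
    then have c: "c (26 + 2 * k) = 0.7" using assms by (auto simp: c_def)
    show ?thesis unfolding c
      by (rule geometric_bound[of "0.7" "5234 / 10000" "1.068164" 5 "1.3906" k 2 "0.0002491" 4 25])
        (use 2 assms in \<open>simp_all add: power_divide\<close>)
  next
    case 3
    then have c: "c (26 + 2 * k) = 0.71" using assms by (auto simp: c_def)
    show ?thesis unfolding c
      by (rule geometric_bound[of "0.71" "5234 / 10000" "1.038287" 9 "1.4024" k 3 "0.0002491" 4 25])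
        (use 3 assms in \<open>simp_all add: power_divide\<close>)
  next
    case 4
    then have c: "c (26 + 2 * k) = 0.72" using assms by (auto simp: c_def)
    show ?thesis unfolding c
      by (rule geometric_bound[of "0.72" "5234 / 10000" "1.009646" 12 "1.1221" k 12 "0.0002491" 4 25])
        (use 4 assms in \<open>simp_all add: power_divide\<close>)
  next
    case 5
    then have c: "c (26 + 2 * k) = 0.73" using assms by (auto simp: c_def)
    show ?thesis unfolding c
      by (rule geometric_bound[of "0.73" "5234 / 10000" "1" 450 "1" k 1 "0.0002491" 4 25])
        (use 5 assms in \<open>simp_all add: power_divide\<close>)
  qed
qed

lemma geometric_bound_odd:
  assumes "27 + 2 * k \<le> 450"
  shows "(5234 / 10000) ^ k * 0.0001 \<le> 2 * c (27 + 2 * k) ^ (26 + 2 * k)"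
proof -
  consider "k \<le> 2" | "3 \<le> k" "k \<le> 9" | "10 \<le> k" "k \<le> 26" | "27 \<le> k" "k \<le> 140" | "141 \<le> k"
    by linarith
  then show ?thesis
  proof cases
    case 1
    then have c: "c (27 + 2 * k) = 0.69" using assms by (auto simp: c_def)
    show ?thesis unfolding c
      by (rule geometric_bound[of "0.69" "5234 / 10000" "1.099349" 2 "1.2086" k 1 "0.0001" 2 26])
        (use 1 assms in \<open>simp_all add: power_divide\<close>)
  next
    case 2
    then have c: "c (27 + 2 * k) = 0.7" using assms by (auto simp: c_def)
    show ?thesis unfolding c
      by (rule geometric_bound[of "0.7" "5234 / 10000" "1.068164" 3 "1.2188" k 3 "0.0001" 2 26])
        (use 2 assms in \<open>simp_all add: power_divide\<close>)
  next
    case 3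
    then have c: "c (27 + 2 * k) = 0.71" using assms by (auto simp: c_def)
    show ?thesis unfolding c
      by (rule geometric_bound[of "0.71" "5234 / 10000" "1.038287" 13 "1.6298" k 2 "0.0001" 2 26])
        (use 3 assms in \<open>simp_all add: power_divide\<close>)
  next
    case 4
    then have c: "c (27 + 2 * k) = 0.72" using assms by (auto simp: c_def)
    show ?thesis unfolding c
      by (rule geometric_bound[of "0.72" "5234 / 10000" "1.009646" 14 "1.1439" k 10 "0.0001" 2 26])
        (use 4 assms in \<open>simp_all add: power_divide\<close>)
  next
    case 5
    then have c: "c (27 + 2 * k) = 0.73" using assms by (auto simp: c_def)
    show ?thesis unfolding c
      by (rule geometric_bound[of "0.73" "5234 / 10000" "1" 450 "1" k 1 "0.0001" 2 26])
        (use 5 assms in \<open>simp_all add: power_divide\<close>)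
  qed
qed

lemma start_bounds_le:
  assumes "k < 26"
  shows "real_of_int (start_bounds ! k) / 10 ^ 7 \<le> (if even k then 4 else 2) * c (k + 2) ^ (k + 1)"
proof -
  have "\<forall>k\<in>set [0..<26]. real_of_int (start_bounds ! k) / 10 ^ 7
      \<le> (if even k then 4 else 2) * c (k + 2) ^ (k + 1)"
    by (simp add: upt_rec start_bounds_def c_def power_divide)
  then show ?thesis using assms by simp
qed

section \<open>Validity of the grid bounds for the sieve functions\<close>

context
  fixes f :: "nat \<Rightarrow> real \<Rightarrow> real"
  assumes sys: "sieve_system f"
begin

lemma sieve_at_eight:
  assumes "n \<ge> 1"
  shows "8 * f (Suc n) 8 \<le> 7 * f n 7 / 7"
proof (cases "n = 1")
  case True
  then show ?thesis using sieve_vanishes[OF sys, of 1 7] sieve_vanishes[OF sys, of 2 8]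
    by (simp add: numeral_2_eq_2)
next
  case False
  then show ?thesis using sieve_le_previous[OF sys, of n 8] assms by (simp add: kink_def)
qed

lemma dominates_grid_step:
  assumes "n \<ge> 1" "0 \<le> A"
    and L: "dominates A (\<lambda>s. s * f n s) (if even n then 32 else 16) L"
  shows "dominates A (\<lambda>s. s * f (Suc n) s) (if even n then 16 else 32) (grid_step (odd n) L)"
proof -
  define i :: int where "i = (if even n then 32 else 16)"
  have sums: "dominates A (\<lambda>s. s * f (Suc n) s) (i + 16) (grid_sums i L)"
  proof (rule dominates_grid_sums[OF assms(2)])
    fix j :: int assume j: "i \<le> j" "j < 112"
    let ?x = "of_int (j + 16) / (16 :: real)" and ?y = "of_int (j + 17) / (16 :: real)"
    have "real_of_int i \<le> of_int j" using j by simp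
    then have x: "kink (Suc n) \<le> ?x" by (simp add: kink_def i_def split: if_splits)
    have "?y \<le> 4 \<or> kink n + 1 \<le> ?x"
    \<comment> \<open>No cell straddles 4, the kink at 3 shifted by one: \<open>?y \<le> 4\<close>
      for \<open>j \<le> 47\<close> and \<open>?x \<ge> 4\<close> from 48 on.\<close>
    proof (cases "j \<le> 47")
      case True
      then have "real_of_int j \<le> 47" by simp
      then show ?thesis by simp
    next
      case False
      then have "48 \<le> real_of_int j" by simp
      then show ?thesis by (simp add: kink_def)
    qed
    note trapezoid = sieve_trapezoid[OF sys assms(1) x _ this]
    have shift: "?x - 1 = of_int j / 16" "?y - 1 = of_int (j + 1) / 16" "?y - ?x = 1 / 16"
      by (simp_all add: field_simps)
    have le: "?x * f (Suc n) ?x \<le> ?y * f (Suc n) ?y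
        + 1 / 16 / 2 * (f n (of_int j / 16) + f n (of_int (j + 1) / 16))"
      using trapezoid unfolding shift by simp
    have "j \<noteq> 0" "j + 1 \<noteq> 0" using j by (auto simp: i_def split: if_splits)
    then have quot: "of_int j / 16 * f n (of_int j / 16) / of_int j = f n (of_int j / 16) / 16"
      "of_int (j + 1) / 16 * f n (of_int (j + 1) / 16) / of_int (j + 1) = f n (of_int (j + 1) / 16) / 16"
      by (simp_all only: of_int_eq_0_iff times_divide_eq_left times_divide_eq_right
          nonzero_mult_div_cancel_left divide_divide_eq_left mult.commute[of 16]
          nonzero_mult_divide_mult_cancel_left not_False_eq_True)
    show "?x * f (Suc n) ?x \<le> ?y * f (Suc n) ?y
        + (of_int j / 16 * f n (of_int j / 16) / of_int j
          + of_int (j + 1) / 16 * f n (of_int (j + 1) / 16) / of_int (j + 1)) / 2"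
      unfolding quot using le by (simp only: add_divide_distrib distrib_left)
  qed (use L sieve_at_eight[OF assms(1)] in \<open>auto simp: i_def\<close>)
  show ?thesis
  proof (cases "even n")
    case False
    then show ?thesis using sums by (simp add: grid_step_def i_def)
  next
    case True
    show ?thesis
    proof (cases "grid_sums i L")
      case Nil
      then show ?thesis using True by (simp add: grid_step_def i_def)
    next
      case (Cons a M)
      have "dominates A (\<lambda>s. s * f (Suc n) s) 16 (replicate 32 a @ a # M)"
      proof (rule dominates_replicate_append)
        fix j :: int assume j: "16 \<le> j" "j < 16 + int 32"
        have "16 \<le> real_of_int j" "real_of_int j \<le> 48" using j by simp_all
        then have "of_int j / 16 * f (Suc n) (of_int j / 16) = 3 * f (Suc n) 3"
          using True assms(1) by (intro sieve_const[OF sys]) auto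
        then show "of_int j / 16 * f (Suc n) (of_int j / 16) \<le> A * of_int a"
          using sums Cons True by (simp add: i_def)
      qed (use sums Cons True in \<open>simp add: i_def\<close>)
      then show ?thesis using Cons True by (simp add: grid_step_def i_def)
    qed
  qed
qed

lemma dominates_grid:
  "dominates (1 / 10 ^ 14) (\<lambda>s. s * f (Suc n) s) (if even n then 16 else 32) (grid n)"
proof (induction n)
  case 0
  have "dominates (1 / 10 ^ 14) (\<lambda>s. s * f 1 s) 16
      (map (\<lambda>i. max 0 (48 - i) * 6250000000000) [16..128])"
  proof (rule dominates_map_upto)
    fix j :: int assume "16 \<le> j" "j \<le> 128"
    then have "1 \<le> real_of_int j / 16" by simp
    from sieve_first[OF sys this]
    show "of_int j / 16 * f 1 (of_int j / 16) \<le> 1 / 10 ^ 14 * of_int (max 0 (48 - j) * 6250000000000)"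
      \<comment> \<open>Equality holds: 6250000000000 is \<open>10 ^ 14 / 16\<close>.\<close>
      by (simp add: max_def)
  qed
  then show ?case by simp
next
  case (Suc n)
  then show ?case
    using dominates_grid_step[of "Suc n" "1 / 10 ^ 14" "grid n"] by (cases "even n") simp_all
qed

text \<open>The ratios 2 and 6 in \<open>bounded_by\<close> are those of the thresholds
  \<open>4 * k\<close>, \<open>2 * k\<close>, \<open>2 / 3 * k\<close>, so only the head of the list
  is compared with \<open>k\<close>.\<close>

lemma sieve_bound_of_dominates:
  assumes "n \<ge> 2" "0 \<le> A"
    and L: "dominates A (\<lambda>s. s * f n s) (if even n then 32 else 16) L" "bounded_by (even n) b L"
    and b: "A * 10 ^ 7 * of_int b \<le> (if even n then 4 else 2) * k"
    and s: "odd n \<and> s \<ge> 1 \<or> even n \<and> s \<ge> 2"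
  shows "f n s \<le> 2 * (exp 1)\<^sup>2 * k * h s"
proof -
  have len: "32 < length L" and hd: "hd L \<le> b * 10 ^ 7" using L by (simp_all add: bounded_by_def)
  then have L0: "L \<noteq> []" "L ! 0 = hd L" by (cases L; auto)+
  have "A * of_int (hd L) \<le> A * of_int (b * 10 ^ 7)"
    using hd assms(2) by (intro mult_left_mono) (simp_all only: of_int_le_iff)
  then have A0: "A * of_int (hd L) \<le> (if even n then 4 else 2) * k" using b by (simp add: mult_ac)
  show ?thesis
  proof (cases "even n")
    case True
    have "2 * (L ! 16) \<le> hd L" "6 * (L ! 32) \<le> hd L"
      using L True by (simp_all add: bounded_by_def)
    then have "real_of_int (L ! 16) \<le> of_int (hd L) / 2" "real_of_int (L ! 32) \<le> of_int (hd L) / 6"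
      by linarith+
    then have "A * of_int (L ! 16) \<le> A * (of_int (hd L) / 2)" "A * of_int (L ! 32) \<le> A * (of_int (hd L) / 6)"
      by (auto intro!: mult_left_mono assms(2) simp del: times_divide_eq_right)
    moreover have "2 * f n 2 \<le> A * of_int (hd L)" "3 * f n 3 \<le> A * of_int (L ! 16)"
        "4 * f n 4 \<le> A * of_int (L ! 32)"
      using dominates_nth[OF L(1), of 0] dominates_nth[OF L(1), of 16] dominates_nth[OF L(1), of 32]
        len True L0 by simp_all
    ultimately have "2 * f n 2 \<le> 4 * k" "3 * f n 3 \<le> 2 * k" "4 * f n 4 \<le> 2 / 3 * k"
      using A0 True by simp_all
    then show ?thesis using sieve_bound_even[OF sys] assms True by blast
  next
    case False
    have "1 * f n 1 \<le> A * of_int (hd L)"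
      using dominates_nth[OF L(1), of 0] len False L0 by auto
    moreover have "n \<ge> 3" using False assms(1) by (cases "n = 2") auto
    moreover have "1 * f n 1 = 3 * f n 3"
      by (rule sieve_const[OF sys]) (use False assms(1) in auto)
    ultimately have "3 * f n 3 \<le> 2 * k" using A0 False by simp
    then show ?thesis using sieve_bound_odd[OF sys] \<open>n \<ge> 3\<close> False s by blast
  qed
qed

text \<open>A grid step is valid in every unit. Two steps from \<open>grid 25\<close> give a list at
  most 0.5234 times \<open>grid 25\<close>, so \<open>grid 25\<close> serves again in the smaller
  unit.\<close>

lemma dominates_grid_later:
  "dominates ((5234 / 10000) ^ k / 10 ^ 14) (\<lambda>s. s * f (26 + 2 * k) s) 32 (grid 25)"
proof (induction k)
  case 0
  then show ?case using dominates_grid[of 25] by simp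
next
  case (Suc k)
  let ?A = "(5234 / 10000) ^ k / 10 ^ 14 :: real"
  have A: "0 \<le> ?A" by simp
  have "dominates ?A (\<lambda>s. s * f (27 + 2 * k) s) 16 (grid_step False (grid 25))"
    using dominates_grid_step[OF _ A, of "26 + 2 * k"] Suc by simp
  then have "dominates ?A (\<lambda>s. s * f (28 + 2 * k) s) 32 (grid_step True (grid_step False (grid 25)))"
    using dominates_grid_step[OF _ A, of "27 + 2 * k"] by simp
  moreover have "contracts (grid 25) (grid_step True (grid_step False (grid 25)))"
    using verified_grid(2)[of 1 start_bounds 24] verified_start
    by (simp add: start_bounds_def grid_27)
  ultimately have "dominates (?A * (5234 / 10000)) (\<lambda>s. s * f (28 + 2 * k) s) 32 (grid 25)"
    using A unfolding contracts_def by (intro dominates_contract)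
  then show ?case by (simp add: mult.commute)
qed

end

theorem theorem2:
  fixes f :: "nat \<Rightarrow> real \<Rightarrow> real" and n :: nat and s :: real
  assumes "sieve_system f"
    and "2 \<le> n" and "n \<le> 450"
    and "odd n \<and> s \<ge> 1 \<or> even n \<and> s \<ge> 2"
  shows "f n s \<le> 2 * (exp 1)\<^sup>2 * c n ^ (n - 1) * h s"
proof -
  have bounded: "bounded_by (even k) (start_bounds ! k) (grid (Suc k))" if "k < 26" for k
    using verified_grid(1)[of 1 start_bounds k] verified_start that by (simp add: start_bounds_def)
  consider k where "n = k + 2" "k < 26" | k where "n = 26 + 2 * k" | k where "n = 27 + 2 * k"
  proof (cases "n < 28")
    case True
    then show thesis using that(1)[of "n - 2"] assms(2) by simp
  next
    case False
    then show thesis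
      using that(2)[of "(n - 26) div 2"] that(3)[of "(n - 27) div 2"] by (cases "even n") (auto elim!: evenE oddE)
  qed
  then show ?thesis
  proof cases
    case (1 k)
    show ?thesis
    proof (rule sieve_bound_of_dominates[OF assms(1,2) _ _ _ _ assms(4)])
      show "dominates (1 / 10 ^ 14) (\<lambda>s. s * f n s) (if even n then 32 else 16) (grid (Suc k))"
        using dominates_grid[OF assms(1), of "Suc k"] 1 by (cases "even k") simp_all
      show "bounded_by (even n) (start_bounds ! k) (grid (Suc k))" using bounded 1 by simp
      show "1 / 10 ^ 14 * 10 ^ 7 * real_of_int (start_bounds ! k)
          \<le> (if even n then 4 else 2) * c n ^ (n - 1)"
        using start_bounds_le[of k] 1 by simp
    qed simp
  next
    case (2 k)
    show ?thesis
    proof (rule sieve_bound_of_dominates[OF assms(1,2) _ _ _ _ assms(4)])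
      show "dominates ((5234 / 10000) ^ k / 10 ^ 14) (\<lambda>s. s * f n s) (if even n then 32 else 16) (grid 25)"
        using dominates_grid_later[OF assms(1)] 2 by simp
      show "bounded_by (even n) 2491 (grid 25)"
        using bounded[of 24] 2 by (simp add: start_bounds_def)
      show "(5234 / 10000) ^ k / 10 ^ 14 * 10 ^ 7 * real_of_int 2491
          \<le> (if even n then 4 else 2) * c n ^ (n - 1)"
        using geometric_bound_even[of k] 2 assms(3) by simp
    qed simp
  next
    case (3 k)
    show ?thesis
    proof (rule sieve_bound_of_dominates[OF assms(1,2) _ _ _ _ assms(4)])
      show "dominates ((5234 / 10000) ^ k / 10 ^ 14) (\<lambda>s. s * f n s) (if even n then 32 else 16) (grid 26)"
        \<comment> \<open>Odd \<open>n\<close> is one grid step after the even index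
          \<open>26 + 2 * k\<close>, in the same unit.\<close>
        using dominates_grid_step[OF assms(1), of "26 + 2 * k" "(5234 / 10000) ^ k / 10 ^ 14" "grid 25"]
          dominates_grid_later[OF assms(1), of k] 3
        by (simp add: grid_26)
      show "bounded_by (even n) 1000 (grid 26)"
        using bounded[of 25] 3 by (simp add: start_bounds_def)
      show "(5234 / 10000) ^ k / 10 ^ 14 * 10 ^ 7 * real_of_int 1000
          \<le> (if even n then 4 else 2) * c n ^ (n - 1)"
        using geometric_bound_odd[of k] 3 assms(3) by simp
    qed simp
  qed
qed

end
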